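(* Let $X_{\mathbb{R}}$ and $Y_{\mathbb{R}}$ be real vector spaces endowed with norms $\|\cdot\|_{X_{\mathbb{R}}}$ and $\|\cdot\|_{Y_{\mathbb{R}}}$, with algebraic complexifications $X$ and $Y$. Let $\nu$ be a monotone and shift-invariant norm on $\mathcal{C}([0,2\pi],\mathbb{R})$, and let the norms on $X$ and $Y$ be defined by $$\|x\|_X=\nu\big(\phi\mapsto\|\operatorname{Re}(e^{i\phi}x)\|_{X_{\mathbb{R}}}\big)\ (x\in X),\qquad \|y\|_Y=\nu\big(\phi\mapsto\|\operatorname{Re}(e^{i\phi}y)\|_{Y_{\mathbb{R}}}\big)\ (y\in Y).$$ Then $\|A\|_{X,Y}^{\mathbb{C}}=\|A\|_{X,Y}^{\mathbb{R}}$ for all $\mathbb{C}$-linear maps $A:X\to Y$ satisfying $A(X_{\mathbb{R}})\subseteq Y_{\mathbb{R}}$.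
   Context: $X$ is the algebraic complexification of $X_{\mathbb{R}}$ if $X$ is a complex vector space and each $x\in X$ can be uniquely written as $x=x_1+ix_2$ with $x_1,x_2\in X_{\mathbb{R}}$; then $\operatorname{Re}x=x_1$ (and likewise for $Y$). $\mathcal{C}([0,2\pi],\mathbb{R})$ is the set of continuous real-valued functions on $[0,2\pi]$. A norm $\nu$ on $\mathcal{C}([0,2\pi],\mathbb{R})$ is called monotone if $0\le f(t)\le g(t)$ for all $t\in[0,2\pi]$ implies $\nu(f)\le\nu(g)$. It is called shift-invariant if $\nu(f)=\nu(f_\psi)$ for all $f\in\mathcal{C}([0,2\pi],\mathbb{R})$ and all $\psi\in\mathbb{R}$, where $f_\psi(\phi)=f((\phi+\psi)\bmod 2\pi)$. The functions $\phi\mapsto\|\operatorname{Re}(e^{i\phi}x)\|_{X_{\mathbb{R}}}$ and $\phi\mapsto\|\operatorname{Re}(e^{i\phi}y)\|_{Y_{\mathbb{R}}}$, $\phi\in[0,2\pi]$, are continuous, and $\|\cdot\|_X,\|\cdot\|_Y$ are norms on $X,Y$. The operator norms (the value $\infty$ is not excluded) are $$\|A\|_{X,Y}^{\mathbb{C}}=\sup_{x\in X\setminus\{0\}}\frac{\|Ax\|_Y}{\|x\|_X},\qquad \|A\|_{X,Y}^{\mathbb{R}}=\sup_{x\in X_{\mathbb{R}}\setminus\{0\}}\frac{\|Ax\|_Y}{\|x\|_X}.$$ *)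

theory Defs
  imports "HOL-Analysis.Analysis" "HOL-Library.Real_Mod"
begin

text \<open>The complex vector space \<open>X\<close> is a whole type, with scaling \<open>s\<close>; \<open>X\<^sub>\<real>\<close> is a real subspace
  \<open>XR\<close> of it, the real scaling being \<open>s\<close> restricted to the reals.\<close>

definition algebraic_complexification ::
    "(complex \<Rightarrow> 'a::ab_group_add \<Rightarrow> 'a) \<Rightarrow> 'a set \<Rightarrow> bool" where
  "algebraic_complexification s XR \<longleftrightarrow>
     vector_space s \<and>
     module.subspace (\<lambda>r::real. s (complex_of_real r)) XR \<and>
     (\<forall>x. \<exists>!(x1, x2). x1 \<in> XR \<and> x2 \<in> XR \<and> x = x1 + s \<i> x2)"

definition Re_part :: "(complex \<Rightarrow> 'a::ab_group_add \<Rightarrow> 'a) \<Rightarrow> 'a set \<Rightarrow> 'a \<Rightarrow> 'a" where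
  "Re_part s XR x = (THE x1. x1 \<in> XR \<and> (\<exists>x2\<in>XR. x = x1 + s \<i> x2))"

definition norm_on_real_subspace ::
    "(complex \<Rightarrow> 'a::ab_group_add \<Rightarrow> 'a) \<Rightarrow> 'a set \<Rightarrow> ('a \<Rightarrow> real) \<Rightarrow> bool" where
  "norm_on_real_subspace s XR N \<longleftrightarrow>
     (\<forall>x\<in>XR. 0 \<le> N x) \<and>
     (\<forall>x\<in>XR. N x = 0 \<longleftrightarrow> x = 0) \<and>
     (\<forall>x\<in>XR. \<forall>r::real. N (s (complex_of_real r) x) = \<bar>r\<bar> * N x) \<and>
     (\<forall>x\<in>XR. \<forall>y\<in>XR. N (x + y) \<le> N x + N y)"

text \<open>An element of \<open>C([0,2\<pi>],\<real>)\<close> is represented by any function on the reals that is continuous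
  on \<open>[0,2\<pi>]\<close>; its values elsewhere are irrelevant (\<open>norm_on_C2pi_cong\<close> below).\<close>

definition C2pi :: "(real \<Rightarrow> real) set" where
  "C2pi = {f. continuous_on {0..2 * pi} f}"

definition norm_on_C2pi :: "((real \<Rightarrow> real) \<Rightarrow> real) \<Rightarrow> bool" where
  "norm_on_C2pi \<nu> \<longleftrightarrow>
     (\<forall>f\<in>C2pi. 0 \<le> \<nu> f) \<and>
     (\<forall>f\<in>C2pi. \<nu> f = 0 \<longleftrightarrow> (\<forall>t\<in>{0..2 * pi}. f t = 0)) \<and>
     (\<forall>f\<in>C2pi. \<forall>r. \<nu> (\<lambda>t. r * f t) = \<bar>r\<bar> * \<nu> f) \<and>
     (\<forall>f\<in>C2pi. \<forall>g\<in>C2pi. \<nu> (\<lambda>t. f t + g t) \<le> \<nu> f + \<nu> g)"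

lemma norm_on_C2pi_cong:
  assumes "norm_on_C2pi \<nu>" "f \<in> C2pi" "g \<in> C2pi" "\<And>t. t \<in> {0..2 * pi} \<Longrightarrow> f t = g t"
  shows "\<nu> f = \<nu> g"
proof -
  have le: "\<nu> f \<le> \<nu> g"
    if "f \<in> C2pi" "g \<in> C2pi" "\<And>t. t \<in> {0..2 * pi} \<Longrightarrow> f t = g t" for f g
  proof -
    have d: "(\<lambda>t. f t - g t) \<in> C2pi"
      using that(1,2) by (auto simp: C2pi_def intro: continuous_on_diff)
    have tri: "\<forall>f\<in>C2pi. \<forall>g\<in>C2pi. \<nu> (\<lambda>t. f t + g t) \<le> \<nu> f + \<nu> g"
      using assms(1) by (simp add: norm_on_C2pi_def)
    have "\<nu> (\<lambda>t. g t + (f t - g t)) \<le> \<nu> g + \<nu> (\<lambda>t. f t - g t)"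
      using tri[rule_format, OF that(2) d] .
    moreover have "\<nu> (\<lambda>t. f t - g t) = 0"
      using assms(1) d that(3) by (auto simp: norm_on_C2pi_def)
    ultimately show ?thesis by simp
  qed
  show ?thesis
    using le[of f g] le[of g f] assms(2-4) by (simp add: order_antisym)
qed

definition monotone_norm :: "((real \<Rightarrow> real) \<Rightarrow> real) \<Rightarrow> bool" where
  "monotone_norm \<nu> \<longleftrightarrow>
     (\<forall>f\<in>C2pi. \<forall>g\<in>C2pi. (\<forall>t\<in>{0..2 * pi}. 0 \<le> f t \<and> f t \<le> g t) \<longrightarrow> \<nu> f \<le> \<nu> g)"

definition shift :: "real \<Rightarrow> (real \<Rightarrow> real) \<Rightarrow> real \<Rightarrow> real" where
  "shift \<psi> f = (\<lambda>\<phi>. f ((\<phi> + \<psi>) rmod (2 * pi)))"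

text \<open>The shift of \<open>f\<close> is continuous on \<open>[0,2\<pi>]\<close> only if \<open>f 0 = f (2\<pi>)\<close>; for other \<open>f\<close>
  the norm of the shift is not defined, so they are exempt.\<close>

definition shift_invariant :: "((real \<Rightarrow> real) \<Rightarrow> real) \<Rightarrow> bool" where
  "shift_invariant \<nu> \<longleftrightarrow> (\<forall>f\<in>C2pi. \<forall>\<psi>. shift \<psi> f \<in> C2pi \<longrightarrow> \<nu> f = \<nu> (shift \<psi> f))"

definition complexified_norm ::
    "((real \<Rightarrow> real) \<Rightarrow> real) \<Rightarrow> (complex \<Rightarrow> 'a::ab_group_add \<Rightarrow> 'a) \<Rightarrow> 'a set \<Rightarrow> ('a \<Rightarrow> real)
      \<Rightarrow> 'a \<Rightarrow> real" where
  "complexified_norm \<nu> s XR N x = \<nu> (\<lambda>\<phi>. N (Re_part s XR (s (exp (\<i> * complex_of_real \<phi>)) x)))"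

text \<open>The supremum is taken in \<open>[0,\<infinity>]\<close>, so it may be infinite, and it is \<open>0\<close> on the zero space.
  The norms \<open>\<parallel>A\<parallel>\<^sup>\<complex>\<close> and \<open>\<parallel>A\<parallel>\<^sup>\<real>\<close> are the cases \<open>S = UNIV\<close> and \<open>S = XR\<close>.\<close>

definition operator_norm_on ::
    "'a::zero set \<Rightarrow> ('a \<Rightarrow> real) \<Rightarrow> ('b \<Rightarrow> real) \<Rightarrow> ('a \<Rightarrow> 'b) \<Rightarrow> ennreal" where
  "operator_norm_on S NX NY A = (SUP x\<in>S - {0}. ennreal (NY (A x) / NX x))"

end

theory Submission
  imports Defs
begin

text \<open>
  On a real vector \<open>u\<close> the profile \<open>\<phi> \<mapsto> \<parallel>Re (e\<^sup>i\<^sup>\<phi> u)\<parallel>\<close> is \<open>\<bar>cos \<phi>\<bar> \<parallel>u\<parallel>\<close>, so the complexified norm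
  restricted to the real subspace is the given real norm times the positive constant \<open>\<nu> \<bar>cos\<bar>\<close>
  (\<open>complexified_norm_real\<close>). The same constant occurs for \<open>X\<close> and for \<open>Y\<close>, hence it cancels in the
  quotients, and a real bound \<open>\<parallel>A u\<parallel>\<^sub>Y \<le> m \<parallel>u\<parallel>\<^sub>X\<close> says exactly that \<open>\<parallel>A u\<parallel> \<le> m \<parallel>u\<parallel>\<close> for the original
  real norms.

  A linear map preserving the real subspaces commutes with \<open>Re\<close> (\<open>Re_part_linear\<close>). For an arbitrary
  complex \<open>x\<close>, applying the real bound to \<open>u = Re (e\<^sup>i\<^sup>\<phi> x)\<close> for each \<open>\<phi>\<close> therefore bounds the profile
  of \<open>A x\<close> pointwise by \<open>m\<close> times the profile of \<open>x\<close>, and monotonicity of \<open>\<nu>\<close> turns this into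
  \<open>\<parallel>A x\<parallel>\<^sub>Y \<le> m \<parallel>x\<parallel>\<^sub>X\<close>. Monotonicity and homogeneity of \<open>\<nu>\<close> are only available for continuous functions;
  the profiles are continuous because a norm is Lipschitz along the curve
  \<open>cos \<phi> x\<^sub>1 - sin \<phi> x\<^sub>2\<close> (\<open>profile_in_C2pi\<close>).
\<close>

section \<open>The constant relating complexified and real norms\<close>

lemma norm_on_C2pi_scale:
  assumes "norm_on_C2pi \<nu>" "f \<in> C2pi"
  shows "\<nu> (\<lambda>t. r * f t) = \<bar>r\<bar> * \<nu> f"
  using assms by (simp add: norm_on_C2pi_def)

lemma abs_cos_in_C2pi: "(\<lambda>\<phi>. \<bar>cos \<phi>\<bar>) \<in> C2pi"
  unfolding C2pi_def by (auto intro!: continuous_intros)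

lemma norm_abs_cos_pos:
  assumes "norm_on_C2pi \<nu>"
  shows "0 < \<nu> (\<lambda>\<phi>. \<bar>cos \<phi>\<bar>)"
proof -
  have "\<not> (\<forall>t\<in>{0..2 * pi}. \<bar>cos t\<bar> = 0)"
    by (auto intro!: bexI[of _ 0])
  moreover have "0 \<le> \<nu> (\<lambda>\<phi>. \<bar>cos \<phi>\<bar>)"
    and "\<nu> (\<lambda>\<phi>. \<bar>cos \<phi>\<bar>) = 0 \<longleftrightarrow> (\<forall>t\<in>{0..2 * pi}. \<bar>cos t\<bar> = 0)"
    using assms abs_cos_in_C2pi unfolding norm_on_C2pi_def by simp_all
  ultimately show ?thesis by linarith
qed

section \<open>Real parts and the complexified norm\<close>

locale normed_complexification = vector_space s
  for s :: "complex \<Rightarrow> 'a::ab_group_add \<Rightarrow> 'a" +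
  fixes XR :: "'a set" and N :: "'a \<Rightarrow> real"
  assumes complexification: "algebraic_complexification s XR"
    and real_norm: "norm_on_real_subspace s XR N"
begin

lemma real_subspace:
  shows zero_in_real: "0 \<in> XR"
    and add_in_real: "x \<in> XR \<Longrightarrow> y \<in> XR \<Longrightarrow> x + y \<in> XR"
    and scale_in_real: "x \<in> XR \<Longrightarrow> s (complex_of_real r) x \<in> XR"
proof -
  have "module (\<lambda>r::real. s (complex_of_real r))"
    by unfold_locales (simp_all add: scale_right_distrib scale_left_distrib)
  note subspace_def = module.subspace_def[OF this]
  have "0 \<in> XR \<and> (\<forall>x\<in>XR. \<forall>y\<in>XR. x + y \<in> XR) \<and> (\<forall>c. \<forall>x\<in>XR. s (complex_of_real c) x \<in> XR)"
    using complexification by (simp add: algebraic_complexification_def subspace_def)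
  then show "0 \<in> XR" "x \<in> XR \<Longrightarrow> y \<in> XR \<Longrightarrow> x + y \<in> XR"
    "x \<in> XR \<Longrightarrow> s (complex_of_real r) x \<in> XR"
    by auto
qed

lemma real_imaginary_decomposition:
  obtains x1 x2 where "x1 \<in> XR" "x2 \<in> XR" "x = x1 + s \<i> x2"
proof -
  have "\<exists>!(x1, x2). x1 \<in> XR \<and> x2 \<in> XR \<and> x = x1 + s \<i> x2"
    using complexification unfolding algebraic_complexification_def by blast
  then show thesis
    by (rule ex1E) (auto intro: that)
qed

lemma real_imaginary_unique:
  assumes "x1 \<in> XR" "x2 \<in> XR" "y1 \<in> XR" "y2 \<in> XR" "x1 + s \<i> x2 = y1 + s \<i> y2"
  shows "x1 = y1"
proof -
  have "\<exists>!(a, b). a \<in> XR \<and> b \<in> XR \<and> x1 + s \<i> x2 = a + s \<i> b"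
    using complexification unfolding algebraic_complexification_def by blast
  then obtain p where p: "\<And>q. (case q of (a, b) \<Rightarrow> a \<in> XR \<and> b \<in> XR \<and> x1 + s \<i> x2 = a + s \<i> b) \<Longrightarrow> q = p"
    by (elim ex1E) blast
  have "(x1, x2) = p" "(y1, y2) = p"
    using assms by (auto intro!: p)
  then show ?thesis by (metis prod.inject)
qed

lemma Re_part_eq:
  assumes "x1 \<in> XR" "x2 \<in> XR"
  shows "Re_part s XR (x1 + s \<i> x2) = x1"
  unfolding Re_part_def
proof (rule the_equality)
  show "x1 \<in> XR \<and> (\<exists>x2'\<in>XR. x1 + s \<i> x2 = x1 + s \<i> x2')"
    using assms by auto
next
  fix y
  assume "y \<in> XR \<and> (\<exists>y2\<in>XR. x1 + s \<i> x2 = y + s \<i> y2)"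
  then show "y = x1"
    using real_imaginary_unique[OF assms] by metis
qed

lemma Re_part_in_real: "Re_part s XR x \<in> XR"
  by (rule real_imaginary_decomposition[of x]) (simp add: Re_part_eq)

lemma Re_part_rotation:
  assumes "x1 \<in> XR" "x2 \<in> XR"
  shows "Re_part s XR (s (exp (\<i> * complex_of_real \<phi>)) (x1 + s \<i> x2))
    = s (complex_of_real (cos \<phi>)) x1 + s (complex_of_real (- sin \<phi>)) x2"
proof -
  let ?c = "complex_of_real (cos \<phi>)" and ?s = "complex_of_real (sin \<phi>)"
  have e: "exp (\<i> * complex_of_real \<phi>) = ?c + \<i> * ?s"
    by (simp add: exp_Euler cos_of_real sin_of_real)
  have "s (?c + \<i> * ?s) (x1 + s \<i> x2)
      = (s ?c x1 + s (complex_of_real (- sin \<phi>)) x2) + s \<i> (s ?s x1 + s ?c x2)"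
    by (simp add: scale_left_distrib scale_left_diff_distrib scale_right_distrib
        ring_distribs ac_simps)
  then show ?thesis
    unfolding e using Re_part_eq assms by (simp only: add_in_real scale_in_real)
qed

lemma norm_scale: "x \<in> XR \<Longrightarrow> N (s (complex_of_real r) x) = \<bar>r\<bar> * N x"
  and norm_triangle: "x \<in> XR \<Longrightarrow> y \<in> XR \<Longrightarrow> N (x + y) \<le> N x + N y"
  and norm_nonneg: "x \<in> XR \<Longrightarrow> 0 \<le> N x"
  and norm_zero_iff: "x \<in> XR \<Longrightarrow> N x = 0 \<longleftrightarrow> x = 0"
  using real_norm unfolding norm_on_real_subspace_def by auto

text \<open>The difference of two combinations of \<open>x1\<close> and \<open>x2\<close> is the combination of the coefficient
  differences, so this is the reverse triangle inequality. With the coefficients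
  \<open>cos \<phi>\<close> and \<open>- sin \<phi>\<close> it makes the norm along the rotated vector as continuous as \<open>cos\<close> and \<open>sin\<close>.\<close>

lemma norm_combination_lipschitz:
  assumes "x1 \<in> XR" "x2 \<in> XR"
  shows "\<bar>N (s (complex_of_real a) x1 + s (complex_of_real b) x2)
      - N (s (complex_of_real a') x1 + s (complex_of_real b') x2)\<bar>
    \<le> \<bar>a - a'\<bar> * N x1 + \<bar>b - b'\<bar> * N x2"
proof -
  define v where "v a b = s (complex_of_real a) x1 + s (complex_of_real b) x2" for a b :: real
  have v_in: "v a b \<in> XR" for a b
    using assms by (simp add: v_def add_in_real scale_in_real)
  have le: "N (v a b) \<le> N (v a' b') + (\<bar>a - a'\<bar> * N x1 + \<bar>b - b'\<bar> * N x2)" for a b a' b'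
  proof -
    have "v a b = v a' b' + v (a - a') (b - b')"
      by (simp add: v_def scale_left_diff_distrib)
    then have "N (v a b) \<le> N (v a' b') + N (v (a - a') (b - b'))"
      using norm_triangle v_in by metis
    also have "N (v (a - a') (b - b')) \<le> \<bar>a - a'\<bar> * N x1 + \<bar>b - b'\<bar> * N x2"
      unfolding v_def using norm_triangle norm_scale scale_in_real assms by metis
    finally show ?thesis by simp
  qed
  show ?thesis
    using le[of a b a' b'] le[of a' b' a b] unfolding v_def by (simp add: abs_minus_commute)
qed

definition profile :: "'a \<Rightarrow> real \<Rightarrow> real" where
  "profile x \<phi> = N (Re_part s XR (s (exp (\<i> * complex_of_real \<phi>)) x))"

lemma complexified_norm_profile: "complexified_norm \<nu> s XR N x = \<nu> (profile x)"
  by (simp add: complexified_norm_def profile_def[abs_def])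

lemma profile_nonneg: "0 \<le> profile x \<phi>"
  by (simp add: profile_def norm_nonneg Re_part_in_real)

lemma profile_in_C2pi: "profile x \<in> C2pi"
proof -
  obtain x1 x2 where x: "x1 \<in> XR" "x2 \<in> XR" "x = x1 + s \<i> x2"
    by (rule real_imaginary_decomposition)
  have "(profile x \<longlongrightarrow> profile x t) (at t)" for t
  proof -
    have "((\<lambda>\<phi>. \<bar>cos \<phi> - cos t\<bar> * N x1 + \<bar>- sin \<phi> - - sin t\<bar> * N x2) \<longlongrightarrow>
        \<bar>cos t - cos t\<bar> * N x1 + \<bar>- sin t - - sin t\<bar> * N x2) (at t)"
      by (intro tendsto_intros)
    then have lim: "((\<lambda>\<phi>. \<bar>cos \<phi> - cos t\<bar> * N x1 + \<bar>- sin \<phi> - - sin t\<bar> * N x2) \<longlongrightarrow> 0) (at t)"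
      by simp
    have "\<bar>profile x \<phi> - profile x t\<bar> \<le> \<bar>cos \<phi> - cos t\<bar> * N x1 + \<bar>- sin \<phi> - - sin t\<bar> * N x2" for \<phi>
      unfolding profile_def x(3) Re_part_rotation[OF x(1,2)]
      by (rule norm_combination_lipschitz[OF x(1,2)])
    then have "((\<lambda>\<phi>. profile x \<phi> - profile x t) \<longlongrightarrow> 0) (at t)"
      by (intro Lim_null_comparison[OF _ lim]) simp
    then show ?thesis
      by (simp add: LIM_zero_iff)
  qed
  then show ?thesis
    unfolding C2pi_def by (auto intro!: continuous_at_imp_continuous_on simp: isCont_def)
qed

lemma profile_real:
  assumes "u \<in> XR"
  shows "profile u = (\<lambda>\<phi>. N u * \<bar>cos \<phi>\<bar>)"
proof
  fix \<phi>
  show "profile u \<phi> = N u * \<bar>cos \<phi>\<bar>"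
    using Re_part_rotation[OF assms zero_in_real, of \<phi>] norm_scale[OF assms]
    by (simp add: profile_def)
qed

text \<open>The factor does not depend on the space or on its norm; it is therefore common to domain and
  codomain of a map and disappears from the real operator norm.\<close>

lemma complexified_norm_real:
  assumes "norm_on_C2pi \<nu>" "u \<in> XR"
  shows "complexified_norm \<nu> s XR N u = \<nu> (\<lambda>\<phi>. \<bar>cos \<phi>\<bar>) * N u"
proof -
  have "\<nu> (\<lambda>\<phi>. N u * \<bar>cos \<phi>\<bar>) = \<bar>N u\<bar> * \<nu> (\<lambda>\<phi>. \<bar>cos \<phi>\<bar>)"
    by (rule norm_on_C2pi_scale[OF assms(1) abs_cos_in_C2pi])
  then show ?thesis
    using norm_nonneg[OF assms(2)]
    by (simp add: complexified_norm_profile profile_real[OF assms(2)])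
qed

end

section \<open>Maps preserving the real subspace\<close>

locale real_preserving_map =
  X: normed_complexification sX XR NX + Y: normed_complexification sY YR NY
  for sX :: "complex \<Rightarrow> 'a::ab_group_add \<Rightarrow> 'a" and XR NX
    and sY :: "complex \<Rightarrow> 'b::ab_group_add \<Rightarrow> 'b" and YR NY +
  fixes A :: "'a \<Rightarrow> 'b"
  assumes linear: "Vector_Spaces.linear sX sY A" and maps_real: "A ` XR \<subseteq> YR"
begin

lemma map_add: "A (x + y) = A x + A y"
  and map_scale: "A (sX c x) = sY c (A x)"
  and map_zero: "A 0 = 0"
proof -
  interpret Vector_Spaces.linear sX sY A by (rule linear)
  show "A (x + y) = A x + A y" "A (sX c x) = sY c (A x)" "A 0 = 0"
    by (simp_all add: add scale)
qed

text \<open>Applying \<open>A\<close> to \<open>x = x\<^sub>1 + i x\<^sub>2\<close> gives \<open>A x\<^sub>1 + i A x\<^sub>2\<close>, which is again a decomposition into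
  real vectors; uniqueness identifies its first component as \<open>Re (A x)\<close>.\<close>

lemma Re_part_linear: "Re_part sY YR (A x) = A (Re_part sX XR x)"
proof -
  obtain x1 x2 where x: "x1 \<in> XR" "x2 \<in> XR" "x = x1 + sX \<i> x2"
    by (rule X.real_imaginary_decomposition)
  moreover have "A x1 \<in> YR" "A x2 \<in> YR"
    using x maps_real by auto
  ultimately show ?thesis
    by (simp add: X.Re_part_eq Y.Re_part_eq map_add map_scale)
qed

text \<open>Every value of the profile of \<open>A x\<close> is the real norm of the image of a real vector, which is why
  a bound on the real subspace reaches all of \<open>X\<close>.\<close>

lemma complexified_norm_bound:
  assumes \<nu>: "norm_on_C2pi \<nu>" "monotone_norm \<nu>"
    and m: "0 \<le> m" and bound: "\<And>u. u \<in> XR \<Longrightarrow> NY (A u) \<le> m * NX u"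
  shows "complexified_norm \<nu> sY YR NY (A x) \<le> m * complexified_norm \<nu> sX XR NX x"
proof -
  have "Y.profile (A x) \<phi> \<le> m * X.profile x \<phi>" for \<phi>
    unfolding X.profile_def Y.profile_def map_scale[symmetric] Re_part_linear
    by (rule bound[OF X.Re_part_in_real])
  moreover have "(\<lambda>\<phi>. m * X.profile x \<phi>) \<in> C2pi"
    using X.profile_in_C2pi[of x] unfolding C2pi_def by (auto intro!: continuous_intros)
  ultimately have "\<nu> (Y.profile (A x)) \<le> \<nu> (\<lambda>\<phi>. m * X.profile x \<phi>)"
    using \<nu>(2) Y.profile_in_C2pi Y.profile_nonneg by (simp add: monotone_norm_def)
  also have "\<dots> = \<bar>m\<bar> * \<nu> (X.profile x)"
    by (rule norm_on_C2pi_scale[OF \<nu>(1) X.profile_in_C2pi])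
  finally show ?thesis
    using m by (simp add: X.complexified_norm_profile Y.complexified_norm_profile)
qed

lemma real_norm_quotient:
  assumes "norm_on_C2pi \<nu>" "u \<in> XR"
  shows "complexified_norm \<nu> sY YR NY (A u) / complexified_norm \<nu> sX XR NX u = NY (A u) / NX u"
proof -
  have "A u \<in> YR" using assms(2) maps_real by auto
  then show ?thesis
    using norm_abs_cos_pos[OF assms(1)] assms
    by (simp add: X.complexified_norm_real Y.complexified_norm_real)
qed

lemma operator_norm_complexified_eq:
  assumes \<nu>: "norm_on_C2pi \<nu>" "monotone_norm \<nu>"
  defines "nX \<equiv> complexified_norm \<nu> sX XR NX" and "nY \<equiv> complexified_norm \<nu> sY YR NY"
  shows "operator_norm_on UNIV nX nY A = operator_norm_on XR nX nY A"
proof (rule antisym)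
  show "operator_norm_on XR nX nY A \<le> operator_norm_on UNIV nX nY A"
    unfolding operator_norm_on_def by (rule SUP_subset_mono) auto
next
  show "operator_norm_on UNIV nX nY A \<le> operator_norm_on XR nX nY A"
  proof (cases "operator_norm_on XR nX nY A")
    case top
    then show ?thesis by simp
  next
    case (real m)
    have bound: "NY (A u) \<le> m * NX u" if u: "u \<in> XR" for u
    proof (cases "u = 0")
      case True
      then show ?thesis
        using X.norm_zero_iff[OF X.zero_in_real] Y.norm_zero_iff[OF Y.zero_in_real]
        by (simp add: map_zero)
    next
      case False
      then have "ennreal (nY (A u) / nX u) \<le> operator_norm_on XR nX nY A"
        unfolding operator_norm_on_def using u by (intro SUP_upper) auto
      then have "NY (A u) / NX u \<le> m"
        using real u \<nu>(1) by (simp add: nX_def nY_def real_norm_quotient ennreal_le_iff)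
      moreover have "0 < NX u"
        using False X.norm_nonneg[OF u] X.norm_zero_iff[OF u] by simp
      ultimately show ?thesis
        by (simp add: divide_le_eq)
    qed
    have "nY (A x) / nX x \<le> m" for x
    proof -
      have "nY (A x) \<le> m * nX x"
        unfolding nX_def nY_def by (rule complexified_norm_bound[OF \<nu> real(1) bound])
      moreover have "0 \<le> nX x"
        using \<nu>(1) X.profile_in_C2pi
        by (simp add: nX_def X.complexified_norm_profile norm_on_C2pi_def)
      \<comment> \<open>If \<open>nX x = 0\<close>, the quotient is \<open>0\<close> by convention, below the nonnegative \<open>m\<close>.\<close>
      ultimately show ?thesis
        using real(1) by (cases "nX x = 0") (simp_all add: divide_le_eq)
    qed
    then show ?thesis
      unfolding real(2) operator_norm_on_def[of UNIV] by (simp add: SUP_least ennreal_leI)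
  qed
qed

end

theorem proposition5p2:
  fixes sX :: "complex \<Rightarrow> 'a::ab_group_add \<Rightarrow> 'a" and XR :: "'a set" and normXR :: "'a \<Rightarrow> real"
    and sY :: "complex \<Rightarrow> 'b::ab_group_add \<Rightarrow> 'b" and YR :: "'b set" and normYR :: "'b \<Rightarrow> real"
    and \<nu> :: "(real \<Rightarrow> real) \<Rightarrow> real"
    and normX :: "'a \<Rightarrow> real" and normY :: "'b \<Rightarrow> real"
  assumes "algebraic_complexification sX XR" and "norm_on_real_subspace sX XR normXR"
    and "algebraic_complexification sY YR" and "norm_on_real_subspace sY YR normYR"
    and "norm_on_C2pi \<nu>" and "monotone_norm \<nu>" and "shift_invariant \<nu>"
    and "\<And>x. normX x = complexified_norm \<nu> sX XR normXR x"
    and "\<And>y. normY y = complexified_norm \<nu> sY YR normYR y"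
  shows "\<forall>A. Vector_Spaces.linear sX sY A \<and> A ` XR \<subseteq> YR \<longrightarrow>
    operator_norm_on UNIV normX normY A = operator_norm_on XR normX normY A"
proof (intro allI impI)
  fix A :: "'a \<Rightarrow> 'b"
  assume A: "Vector_Spaces.linear sX sY A \<and> A ` XR \<subseteq> YR"
  have "vector_space sX" "vector_space sY"
    using assms(1,3) by (simp_all add: algebraic_complexification_def)
  then interpret real_preserving_map sX XR normXR sY YR normYR A
    using A assms(1-4)
    by (simp add: real_preserving_map_def real_preserving_map_axioms_def
        normed_complexification_def normed_complexification_axioms_def)
  have "normX = complexified_norm \<nu> sX XR normXR" "normY = complexified_norm \<nu> sY YR normYR"
    using assms(8,9) by (simp_all add: fun_eq_iff)
  then show "operator_norm_on UNIV normX normY A = operator_norm_on XR normX normY A"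
    using operator_norm_complexified_eq[OF assms(5,6)] by simp
qed

end
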